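(* Let $H$ be a finite-dimensional real Hilbert space and let $f:H\to\mathbb{R}$ be twice continuously differentiable and bounded below, with nonempty set of minimizers and minimal value $f_\star$. Assume that for some $L_\nu>0$ and $\nu\in[0,1]$ one has $\|\nabla^2 f(x)-\nabla^2 f(y)\|\le L_\nu\|x-y\|^\nu$ for all $x,y\in H$. Consider the exact UniCAT trust-region method (described in the context) with parameter $\vartheta>0$, where the trust-region subproblem is solved exactly at every iteration, and assume $\eta_2<\frac{1}{1+\vartheta}$. Define $$k_{\mathrm{CAT,ncvx}}(\varepsilon):=\min\bigl\{k\in\mathbb{N}:\ \min\{\|\nabla f(x_k)\|,\|\nabla f(x_k+s_k)\|\}\le\varepsilon\bigr\}.$$ Then for all $0<\varepsilon\le(\Delta_0/\gamma_1)^{1+\nu}K_\vartheta$, $$k_{\mathrm{CAT,ncvx}}(\varepsilon)\le\left(1+\frac{\log(\gamma_3)}{|\log(\gamma_2)|}\right)\frac{C_{\mathrm{CAT}}}{\varepsilon^{(2+\nu)/(1+\nu)}}+\frac{1}{|\log(\gamma_2)|}\log_+\!\left(\frac{\Delta_0K_\vartheta^\alpha}{\gamma_1\varepsilon^\alpha}\right),\qquad C_{\mathrm{CAT}}:=\frac{2F_0K_\vartheta^\alpha}{\eta_1\gamma_1\vartheta}.$$ Hence $k_{\mathrm{CAT,ncvx}}(\varepsilon)=\mathcal{O}\bigl(\varepsilon^{-(2+\nu)/(1+\nu)}\bigr)$ as $\varepsilon\downarrow0$.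
   Context: $\mathbb{N}=\{0,1,2,\dots\}$, $\log$ is the natural logarithm and $\log_+(x):=\max(0,\log x)$. Write $g_k:=\nabla f(x_k)$, $H_k:=\nabla^2 f(x_k)$, $m_k(s):=f(x_k)+\langle g_k,s\rangle+\tfrac12\langle H_ks,s\rangle$ and $F_k:=f(x_k)-f_\star$. Constants: $$\alpha:=\frac1{1+\nu},\quad C_f:=\frac{L_\nu}{(1+\nu)(2+\nu)},\quad C_g:=\frac{L_\nu}{1+\nu},\quad a_\vartheta:=\frac{\eta_2\vartheta}{1-\eta_2}<1,\quad K_\vartheta:=\frac{C_g+\frac{2C_f}{1-\eta_2}}{1-a_\vartheta}.$$ Exact UniCAT method. Inputs: $x_0\in H$, $\Delta_0>0$, $\vartheta>0$, constants $0<\eta_1\le\eta_2<1$, $0<\gamma_1\le\gamma_2<1\le\gamma_3$. For $k=0,1,2,\dots$: if $\|g_k\|=0$, terminate and return $x_k$. Otherwise take an exact solution $s_k\in\arg\min_{\|s\|\le\Delta_k}m_k(s)$ and set $$\rho_k^\vartheta:=\frac{f(x_k)-f(x_k+s_k)}{m_k(0)-m_k(s_k)+\frac{\vartheta}{2}\min\{\|\nabla f(x_k)\|,\|\nabla f(x_k+s_k)\|\}\|s_k\|}.$$ Set $x_{k+1}=x_k+s_k$ if $\rho_k^\vartheta\ge\eta_1$ and $x_{k+1}=x_k$ otherwise. Choose $\Delta_{k+1}$ arbitrarily in $[\gamma_1\Delta_k,\gamma_2\Delta_k]$ if $\rho_k^\vartheta<\eta_1$, in $[\gamma_2\Delta_k,\Delta_k]$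 if $\eta_1\le\rho_k^\vartheta<\eta_2$, and in $[\Delta_k,\gamma_3\Delta_k]$ if $\rho_k^\vartheta\ge\eta_2$. Standing convention: the method does not terminate finitely, i.e. $\|\nabla f(x_k)\|>0$ and $f(x_k)-f_\star>0$ for all $k\in\mathbb{N}$. The notation $K(\varepsilon)=\mathcal{O}(\phi(\varepsilon))$ as $\varepsilon\downarrow0$ means: there are $C>0,\varepsilon_0>0$ independent of $\varepsilon$ (possibly depending on problem data and algorithmic parameters) with $K(\varepsilon)\le C\phi(\varepsilon)$ for all $\varepsilon\in(0,\varepsilon_0]$. *)

theory Defs
  imports "HOL-Analysis.Analysis"
begin

definition grad :: "('a::real_inner \<Rightarrow> real) \<Rightarrow> 'a \<Rightarrow> 'a" where
  "grad f x = (THE D. GDERIV f x :> D)"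

text \<open>
  The Hessian is the derivative of the gradient, as a bounded operator, so that the
  norm on Hessians is the operator norm.
\<close>

definition hess :: "('a::euclidean_space \<Rightarrow> real) \<Rightarrow> 'a \<Rightarrow> 'a \<Rightarrow>\<^sub>L 'a" where
  "hess f x = Blinfun (frechet_derivative (grad f) (at x))"

definition twice_continuously_differentiable :: "('a::euclidean_space \<Rightarrow> real) \<Rightarrow> bool" where
  "twice_continuously_differentiable f \<longleftrightarrow>
     f differentiable_on UNIV \<and> grad f differentiable_on UNIV \<and> continuous_on UNIV (hess f)"

text \<open>
  For \<open>\<nu> = 0\<close> and \<open>x = y\<close> the right-hand side is \<open>0\<close> because \<open>0 powr 0 = 0\<close>;
  this is harmless, since the left-hand side vanishes for \<open>x = y\<close>.
\<close>

definition hoelder_hessian :: "('a::euclidean_space \<Rightarrow> real) \<Rightarrow> real \<Rightarrow> real \<Rightarrow> bool" where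
  "hoelder_hessian f L \<nu> \<longleftrightarrow> (\<forall>x y. norm (hess f x - hess f y) \<le> L * norm (x - y) powr \<nu>)"

definition quad_model :: "('a::euclidean_space \<Rightarrow> real) \<Rightarrow> 'a \<Rightarrow> 'a \<Rightarrow> real" where
  "quad_model f x s = f x + grad f x \<bullet> s + 1/2 * (blinfun_apply (hess f x) s \<bullet> s)"

definition cat_ratio :: "('a::euclidean_space \<Rightarrow> real) \<Rightarrow> real \<Rightarrow> 'a \<Rightarrow> 'a \<Rightarrow> real" where
  "cat_ratio f \<theta> x s =
     (f x - f (x + s)) /
     (quad_model f x 0 - quad_model f x s
        + \<theta> / 2 * min (norm (grad f x)) (norm (grad f (x + s))) * norm s)"

text \<open>
  Iterates \<open>x\<close>, steps \<open>s\<close> and radii \<open>\<Delta>\<close> form a run of the exact method. Once the gradient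
  vanishes the method has terminated, and the later entries of the sequences are irrelevant.
\<close>

definition unicat_run ::
    "('a::euclidean_space \<Rightarrow> real) \<Rightarrow> real \<Rightarrow> real \<Rightarrow> real \<Rightarrow> real \<Rightarrow> real \<Rightarrow> real \<Rightarrow> 'a \<Rightarrow> real
     \<Rightarrow> (nat \<Rightarrow> 'a) \<Rightarrow> (nat \<Rightarrow> 'a) \<Rightarrow> (nat \<Rightarrow> real) \<Rightarrow> bool" where
  "unicat_run f \<theta> \<eta>1 \<eta>2 \<gamma>1 \<gamma>2 \<gamma>3 x0 \<Delta>0 x s \<Delta> \<longleftrightarrow>
     x 0 = x0 \<and> \<Delta> 0 = \<Delta>0 \<and>
     (\<forall>k. norm (grad f (x k)) \<noteq> 0 \<longrightarrow>
        is_arg_min (quad_model f (x k)) (\<lambda>d. norm d \<le> \<Delta> k) (s k) \<and>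
        (let \<rho> = cat_ratio f \<theta> (x k) (s k) in
           x (Suc k) = (if \<rho> \<ge> \<eta>1 then x k + s k else x k) \<and>
           \<Delta> (Suc k) \<in>
             (if \<rho> < \<eta>1 then {\<gamma>1 * \<Delta> k .. \<gamma>2 * \<Delta> k}
              else if \<rho> < \<eta>2 then {\<gamma>2 * \<Delta> k .. \<Delta> k}
              else {\<Delta> k .. \<gamma>3 * \<Delta> k})))"

definition nonterminating :: "('a::euclidean_space \<Rightarrow> real) \<Rightarrow> (nat \<Rightarrow> 'a) \<Rightarrow> bool" where
  "nonterminating f x \<longleftrightarrow>
     (\<forall>k. norm (grad f (x k)) > 0 \<and> f (x k) - (INF z. f z) > 0)"

definition cat_reached ::
    "('a::euclidean_space \<Rightarrow> real) \<Rightarrow> (nat \<Rightarrow> 'a) \<Rightarrow> (nat \<Rightarrow> 'a) \<Rightarrow> real \<Rightarrow> nat \<Rightarrow> bool" where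
  "cat_reached f x s \<epsilon> k \<longleftrightarrow>
     min (norm (grad f (x k))) (norm (grad f (x k + s k))) \<le> \<epsilon>"

text \<open>
  The value is unspecified when no such \<open>k\<close> exists; any bound on it has to be stated together
  with the existence of such a \<open>k\<close>.
\<close>

definition k_cat_ncvx ::
    "('a::euclidean_space \<Rightarrow> real) \<Rightarrow> (nat \<Rightarrow> 'a) \<Rightarrow> (nat \<Rightarrow> 'a) \<Rightarrow> real \<Rightarrow> nat" where
  "k_cat_ncvx f x s \<epsilon> = (LEAST k. cat_reached f x s \<epsilon> k)"

definition alpha_exp :: "real \<Rightarrow> real" where
  "alpha_exp \<nu> = 1 / (1 + \<nu>)"

definition C_f :: "real \<Rightarrow> real \<Rightarrow> real" where
  "C_f L \<nu> = L / ((1 + \<nu>) * (2 + \<nu>))"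

definition C_g :: "real \<Rightarrow> real \<Rightarrow> real" where
  "C_g L \<nu> = L / (1 + \<nu>)"

definition a_theta :: "real \<Rightarrow> real \<Rightarrow> real" where
  "a_theta \<theta> \<eta>2 = \<eta>2 * \<theta> / (1 - \<eta>2)"

definition K_theta :: "real \<Rightarrow> real \<Rightarrow> real \<Rightarrow> real \<Rightarrow> real" where
  "K_theta L \<nu> \<theta> \<eta>2 = (C_g L \<nu> + 2 * C_f L \<nu> / (1 - \<eta>2)) / (1 - a_theta \<theta> \<eta>2)"

definition C_cat :: "real \<Rightarrow> real \<Rightarrow> real \<Rightarrow> real \<Rightarrow> real \<Rightarrow> real \<Rightarrow> real \<Rightarrow> real" where
  "C_cat F0 L \<nu> \<theta> \<eta>1 \<eta>2 \<gamma>1 =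
     2 * F0 * K_theta L \<nu> \<theta> \<eta>2 powr alpha_exp \<nu> / (\<eta>1 * \<gamma>1 * \<theta>)"

definition log_plus :: "real \<Rightarrow> real" where
  "log_plus x = max 0 (ln x)"

end

theory Submission
  imports Defs
begin

text \<open>
  Fix \<open>\<epsilon>\<close>, let \<open>m\<close> be the smaller of the two gradient norms at a step \<open>s\<close>, and suppose
  \<open>m > \<epsilon>\<close>. An exact step has predicted decrease at least \<open>norm r * norm s / 2\<close>, where
  \<open>r = g + H s\<close>, while \<open>m \<le> norm r + C\<^sub>g norm s powr (1 + \<nu>)\<close>. If the ratio is below \<open>\<eta>\<^sub>2\<close>,
  the Taylor error bound on \<open>f\<close> limits \<open>norm r\<close>, which gives
  \<open>\<epsilon> \<le> K norm s powr (1 + \<nu>)\<close>. Hence the radius never drops below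
  \<open>\<delta> = \<gamma>\<^sub>1 (\<epsilon> / K) powr \<alpha>\<close>. A step in the interior of the trust region has \<open>r = 0\<close> and is
  therefore long as well, so every successful step decreases \<open>f\<close> by at least
  \<open>\<eta>\<^sub>1 \<theta> \<epsilon> \<delta> / 2\<close>. This bounds the number of successes, and the lower bound on the radius
  bounds the failures in terms of the successes.
\<close>

section \<open>Gradient and Hessian as derivatives along lines\<close>

text \<open>The Riesz representative of the derivative \<open>f'\<close> is
  \<open>adjoint f' 1\<close>. Derivatives are unique, so the definite description in
  \<open>grad\<close> denotes this vector.\<close>

lemma GDERIV_grad:
  fixes f :: "'a::euclidean_space \<Rightarrow> real"
  assumes "f differentiable (at x)"
  shows "GDERIV f x :> grad f x"
proof -
  obtain f' where f': "(f has_derivative f') (at x)"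
    using assms unfolding differentiable_def by blast
  then have lin: "linear f'"
    by (rule has_derivative_linear)
  have "f' = (\<lambda>h. h \<bullet> adjoint f' 1)"
    by (simp add: adjoint_works[OF lin])
  with f' have D: "GDERIV f x :> adjoint f' 1"
    unfolding gderiv_def by metis
  have "E = adjoint f' 1" if "GDERIV f x :> E" for E
  proof -
    have "(\<lambda>h. h \<bullet> E) = (\<lambda>h. h \<bullet> adjoint f' 1)"
      using has_derivative_unique that D unfolding gderiv_def by blast
    then show ?thesis
      by (metis vector_eq_ldot)
  qed
  then show ?thesis
    unfolding grad_def using D by (metis theI)
qed

lemma has_derivative_hess:
  assumes "grad f differentiable (at x)"
  shows "(grad f has_derivative blinfun_apply (hess f x)) (at x)"
  using assms unfolding hess_def frechet_derivative_works
  by (metis bounded_linear_Blinfun_apply has_derivative_bounded_linear)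

locale C2 =
  fixes f :: "'a::euclidean_space \<Rightarrow> real"
  assumes twice_cont_diff: "twice_continuously_differentiable f"
begin

lemma f_has_derivative: "(f has_derivative (\<lambda>h. h \<bullet> grad f x)) (at x)"
  using GDERIV_grad[of f x] twice_cont_diff
  unfolding gderiv_def twice_continuously_differentiable_def differentiable_on_def by simp

lemma grad_has_derivative: "(grad f has_derivative blinfun_apply (hess f x)) (at x)"
  using has_derivative_hess[of f x] twice_cont_diff
  unfolding twice_continuously_differentiable_def differentiable_on_def by simp

lemma f_line_derivative:
  "((\<lambda>t. f (y + t *\<^sub>R d)) has_real_derivative grad f (y + t *\<^sub>R d) \<bullet> d) (at t)"
proof -
  have "((\<lambda>t. f (y + t *\<^sub>R d)) has_derivative (\<lambda>h. (h *\<^sub>R d) \<bullet> grad f (y + t *\<^sub>R d))) (at t)"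
    by (rule has_derivative_compose[where g=f, OF _ f_has_derivative])
       (auto intro!: derivative_eq_intros)
  moreover have "(\<lambda>h. (h *\<^sub>R d) \<bullet> grad f (y + t *\<^sub>R d)) = (*) (grad f (y + t *\<^sub>R d) \<bullet> d)"
    by (auto simp: inner_commute)
  ultimately show ?thesis
    unfolding has_field_derivative_def by simp
qed

lemma grad_line_derivative:
  "((\<lambda>t. grad f (y + t *\<^sub>R d)) has_vector_derivative hess f (y + t *\<^sub>R d) d) (at t)"
proof -
  have "((\<lambda>t. grad f (y + t *\<^sub>R d)) has_derivative (\<lambda>h. hess f (y + t *\<^sub>R d) (h *\<^sub>R d))) (at t)"
    by (rule has_derivative_compose[where g="grad f", OF _ grad_has_derivative])
       (auto intro!: derivative_eq_intros)
  then show ?thesis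
    unfolding has_vector_derivative_def by (simp add: blinfun.scaleR_right)
qed

section \<open>Symmetry of the Hessian\<close>

text \<open>Two applications of the mean value theorem: first along \<open>u\<close>, to the
  difference of \<open>f\<close> on two parallel lines, then along \<open>v\<close>, to the
  \<open>u\<close>-component of the gradient. The left-hand side is symmetric in \<open>u\<close>
  and \<open>v\<close>, which gives the symmetry of the Hessian in the limit.\<close>

lemma mixed_second_difference:
  assumes "t > 0"
  obtains \<xi> \<tau> where "0 < \<xi>" "\<xi> < t" "0 < \<tau>" "\<tau> < t"
    "f (y + t *\<^sub>R u + t *\<^sub>R v) - f (y + t *\<^sub>R u) - f (y + t *\<^sub>R v) + f y
       = t\<^sup>2 * (hess f (y + \<xi> *\<^sub>R u + \<tau> *\<^sub>R v) v \<bullet> u)"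
proof -
  let ?\<phi> = "\<lambda>a. f ((y + t *\<^sub>R v) + a *\<^sub>R u) - f (y + a *\<^sub>R u)"
  have "\<exists>\<xi>. 0 < \<xi> \<and> \<xi> < t \<and> ?\<phi> t - ?\<phi> 0 =
      (t - 0) * (grad f ((y + t *\<^sub>R v) + \<xi> *\<^sub>R u) \<bullet> u - grad f (y + \<xi> *\<^sub>R u) \<bullet> u)"
    by (rule MVT2[OF assms]) (intro DERIV_diff f_line_derivative)
  then obtain \<xi> where \<xi>: "0 < \<xi>" "\<xi> < t" and eq1: "?\<phi> t - ?\<phi> 0 =
      t * (grad f ((y + t *\<^sub>R v) + \<xi> *\<^sub>R u) \<bullet> u - grad f (y + \<xi> *\<^sub>R u) \<bullet> u)"
    by auto
  let ?\<psi> = "\<lambda>b. grad f ((y + \<xi> *\<^sub>R u) + b *\<^sub>R v) \<bullet> u"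
  have der: "(?\<psi> has_real_derivative hess f ((y + \<xi> *\<^sub>R u) + b *\<^sub>R v) v \<bullet> u) (at b)" for b
    unfolding has_real_derivative_iff_has_vector_derivative
    by (rule bounded_linear.has_vector_derivative[OF bounded_linear_inner_left grad_line_derivative])
  have "\<exists>\<tau>. 0 < \<tau> \<and> \<tau> < t \<and> ?\<psi> t - ?\<psi> 0 =
      (t - 0) * (hess f ((y + \<xi> *\<^sub>R u) + \<tau> *\<^sub>R v) v \<bullet> u)"
    by (rule MVT2[OF assms der])
  then obtain \<tau> where \<tau>: "0 < \<tau>" "\<tau> < t" and eq2: "?\<psi> t - ?\<psi> 0 =
      t * (hess f ((y + \<xi> *\<^sub>R u) + \<tau> *\<^sub>R v) v \<bullet> u)"
    by auto
  show ?thesis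
  proof (rule that[OF \<xi> \<tau>])
    have "y + t *\<^sub>R v + \<xi> *\<^sub>R u = y + \<xi> *\<^sub>R u + t *\<^sub>R v" "y + t *\<^sub>R v + t *\<^sub>R u = y + t *\<^sub>R u + t *\<^sub>R v"
      by simp_all
    with eq1 eq2 show "f (y + t *\<^sub>R u + t *\<^sub>R v) - f (y + t *\<^sub>R u) - f (y + t *\<^sub>R v) + f y
       = t\<^sup>2 * (hess f (y + \<xi> *\<^sub>R u + \<tau> *\<^sub>R v) v \<bullet> u)"
      by (simp add: power2_eq_square)
  qed
qed

text \<open>Schwarz's theorem: the second difference is evaluated in both orders of \<open>u\<close>
  and \<open>v\<close>, divided by the squared step, and the step tends to 0; continuity of the
  Hessian identifies the limits.\<close>

lemma hess_symmetric: "hess f y u \<bullet> v = hess f y v \<bullet> u"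
proof -
  have iso: "isCont (hess f) y"
    using twice_cont_diff unfolding twice_continuously_differentiable_def
    by (simp add: continuous_on_eq_continuous_at)
  let ?t = "\<lambda>n::nat. inverse (real (Suc n))"
  have t: "?t n > 0" for n by simp
  have t0: "?t \<longlonglongrightarrow> 0"
    by (rule LIMSEQ_inverse_real_of_nat)
  have "\<exists>\<xi> \<tau> \<xi>' \<tau>'. 0 < \<xi> \<and> \<xi> < ?t n \<and> 0 < \<tau> \<and> \<tau> < ?t n \<and> 0 < \<xi>' \<and> \<xi>' < ?t n \<and> 0 < \<tau>' \<and> \<tau>' < ?t n
      \<and> hess f (y + \<xi> *\<^sub>R u + \<tau> *\<^sub>R v) v \<bullet> u = hess f (y + \<xi>' *\<^sub>R v + \<tau>' *\<^sub>R u) u \<bullet> v" for n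
  proof -
    obtain \<xi> \<tau> where 1: "0 < \<xi>" "\<xi> < ?t n" "0 < \<tau>" "\<tau> < ?t n"
      "f (y + ?t n *\<^sub>R u + ?t n *\<^sub>R v) - f (y + ?t n *\<^sub>R u) - f (y + ?t n *\<^sub>R v) + f y
       = (?t n)\<^sup>2 * (hess f (y + \<xi> *\<^sub>R u + \<tau> *\<^sub>R v) v \<bullet> u)"
      by (rule mixed_second_difference[OF t])
    obtain \<xi>' \<tau>' where 2: "0 < \<xi>'" "\<xi>' < ?t n" "0 < \<tau>'" "\<tau>' < ?t n"
      "f (y + ?t n *\<^sub>R v + ?t n *\<^sub>R u) - f (y + ?t n *\<^sub>R v) - f (y + ?t n *\<^sub>R u) + f y
       = (?t n)\<^sup>2 * (hess f (y + \<xi>' *\<^sub>R v + \<tau>' *\<^sub>R u) u \<bullet> v)"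
      by (rule mixed_second_difference[OF t])
    have comm: "y + ?t n *\<^sub>R v + ?t n *\<^sub>R u = y + ?t n *\<^sub>R u + ?t n *\<^sub>R v"
      by simp
    have "(?t n)\<^sup>2 * (hess f (y + \<xi> *\<^sub>R u + \<tau> *\<^sub>R v) v \<bullet> u) = (?t n)\<^sup>2 * (hess f (y + \<xi>' *\<^sub>R v + \<tau>' *\<^sub>R u) u \<bullet> v)"
      using 1(5) 2(5) unfolding comm by linarith
    moreover have "(?t n)\<^sup>2 \<noteq> 0"
      using t[of n] by (intro power_not_zero) linarith
    ultimately show ?thesis
      using 1 2 mult_left_cancel by blast
  qed
  then obtain \<xi> \<tau> \<xi>' \<tau>' where
      b: "\<And>n. 0 < \<xi> n" "\<And>n. \<xi> n < ?t n" "\<And>n. 0 < \<tau> n" "\<And>n. \<tau> n < ?t n"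
         "\<And>n. 0 < \<xi>' n" "\<And>n. \<xi>' n < ?t n" "\<And>n. 0 < \<tau>' n" "\<And>n. \<tau>' n < ?t n"
    and eq: "\<And>n. hess f (y + \<xi> n *\<^sub>R u + \<tau> n *\<^sub>R v) v \<bullet> u = hess f (y + \<xi>' n *\<^sub>R v + \<tau>' n *\<^sub>R u) u \<bullet> v"
    by metis
  have lim0: "z \<longlonglongrightarrow> 0" if "\<And>n. 0 < z n" "\<And>n. z n < ?t n" for z :: "nat \<Rightarrow> real"
    by (rule tendsto_sandwich[OF _ _ tendsto_const t0]) (simp_all add: that less_imp_le del: of_nat_Suc)
  have lim: "(\<lambda>n. hess f (y + z n *\<^sub>R a + w n *\<^sub>R b) b \<bullet> a) \<longlonglongrightarrow> hess f y b \<bullet> a"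
    if "z \<longlonglongrightarrow> 0" "w \<longlonglongrightarrow> 0" for z w :: "nat \<Rightarrow> real" and a b
  proof -
    have "(\<lambda>n. y + z n *\<^sub>R a + w n *\<^sub>R b) \<longlonglongrightarrow> y + 0 *\<^sub>R a + 0 *\<^sub>R b"
      by (intro tendsto_intros that)
    then have "(\<lambda>n. hess f (y + z n *\<^sub>R a + w n *\<^sub>R b)) \<longlonglongrightarrow> hess f y"
      using isCont_tendsto_compose[OF iso] by simp
    then show ?thesis
      by (intro tendsto_intros blinfun.tendsto)
  qed
  have "(\<lambda>n. hess f (y + \<xi> n *\<^sub>R u + \<tau> n *\<^sub>R v) v \<bullet> u) \<longlonglongrightarrow> hess f y v \<bullet> u"
    by (intro lim lim0 b)
  moreover have "(\<lambda>n. hess f (y + \<xi> n *\<^sub>R u + \<tau> n *\<^sub>R v) v \<bullet> u) \<longlonglongrightarrow> hess f y u \<bullet> v"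
    unfolding eq by (intro lim lim0 b)
  ultimately show ?thesis
    by (rule LIMSEQ_unique[symmetric])
qed

section \<open>Exact solutions of the trust-region subproblem\<close>

text \<open>
  With the residual \<open>r = grad f y + hess f y d\<close>, first-order optimality on the ball gives
  \<open>norm r * \<Delta> \<le> - (r \<bullet> d)\<close>, and comparing \<open>d\<close> with \<open>- d\<close> gives \<open>grad f y \<bullet> d \<le> 0\<close>;
  no Lagrange multiplier is needed.
\<close>

lemma exact_step:
  assumes arg_min: "is_arg_min (quad_model f y) (\<lambda>e. norm e \<le> \<Delta>) d" and "\<Delta> > 0"
  shows "norm d < \<Delta> \<Longrightarrow> grad f y + hess f y d = 0"
    and "norm (grad f y + hess f y d) * norm d \<le> 2 * (quad_model f y 0 - quad_model f y d)"
proof -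
  let ?g = "grad f y" and ?H = "blinfun_apply (hess f y)" and ?q = "quad_model f y"
  define r where "r = ?g + ?H d"
  have min: "?q d \<le> ?q e" if "norm e \<le> \<Delta>" for e
    using arg_min that unfolding is_arg_min_def by force
  have dle: "norm d \<le> \<Delta>"
    using arg_min unfolding is_arg_min_def by blast
  have first_order: "0 \<le> r \<bullet> w" if w: "norm (d + w) \<le> \<Delta>" for w
  proof -
    \<comment> \<open>By convexity the ball contains the segment from \<open>d\<close> to
      \<open>d + w\<close>. The model increment along it, divided by \<open>t\<close>, is
      \<open>r \<bullet> w\<close> up to a term that vanishes as \<open>t\<close> tends to
      0.\<close>
    have key: "0 \<le> r \<bullet> w + t / 2 * (?H w \<bullet> w)" if t: "0 < t" "t \<le> 1" for t
    proof -
      have "norm (d + t *\<^sub>R w) = norm ((1 - t) *\<^sub>R d + t *\<^sub>R (d + w))"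
        by (simp add: algebra_simps)
      also have "\<dots> \<le> (1 - t) * norm d + t * norm (d + w)"
        using t by (intro norm_triangle_le) simp
      also have "\<dots> \<le> (1 - t) * \<Delta> + t * \<Delta>"
        using t dle w by (intro add_mono mult_left_mono) auto
      finally have "?q d \<le> ?q (d + t *\<^sub>R w)"
        by (intro min) (simp add: algebra_simps)
      \<comment> \<open>Symmetry of the Hessian merges the cross terms
        \<open>?H w \<bullet> d\<close> and \<open>?H d \<bullet> w\<close>.\<close>
      moreover have "?q (d + t *\<^sub>R w) - ?q d = t * (r \<bullet> w + t / 2 * (?H w \<bullet> w))"
        using hess_symmetric[of y w d] unfolding quad_model_def r_def
        by (simp add: blinfun.bilinear_simps inner_simps field_simps)
      ultimately have "0 \<le> t * (r \<bullet> w + t / 2 * (?H w \<bullet> w))"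
        by linarith
      then show ?thesis
        using t by (metis mult_pos_neg linorder_not_le)
    qed
    have "(\<lambda>t. r \<bullet> w + t / 2 * (?H w \<bullet> w)) \<midarrow>0\<rightarrow> r \<bullet> w + 0 / 2 * (?H w \<bullet> w)"
      by (intro tendsto_intros) simp
    then have "((\<lambda>t. r \<bullet> w + t / 2 * (?H w \<bullet> w)) \<longlongrightarrow> r \<bullet> w) (at_right 0)"
      using filterlim_at_split by auto
    moreover have "\<forall>\<^sub>F t in at_right 0. 0 \<le> r \<bullet> w + t / 2 * (?H w \<bullet> w)"
      using key by (intro eventually_at_rightI[of 0 1]) auto
    ultimately show ?thesis
      by (rule tendsto_lowerbound) simp
  qed
  have opt: "norm r * \<Delta> \<le> - (r \<bullet> d)"
  proof (cases "r = 0")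
    case False
    \<comment> \<open>This \<open>w\<close> leads from \<open>d\<close> to the point of the ball
      where the linear function given by \<open>r\<close> is smallest.\<close>
    then have "0 \<le> r \<bullet> (- (\<Delta> / norm r) *\<^sub>R r - d)"
      using \<open>\<Delta> > 0\<close> by (intro first_order) simp
    also have "\<dots> = - (norm r * \<Delta>) - r \<bullet> d"
      using False by (simp add: inner_diff_right dot_square_norm power2_eq_square)
    finally show ?thesis by simp
  qed simp
  show "?g + ?H d = 0" if "norm d < \<Delta>"
  proof (rule ccontr)
    assume "?g + ?H d \<noteq> 0"
    then have "norm r * norm d < norm r * \<Delta>"
      using that by (simp add: r_def)
    moreover have "- (r \<bullet> d) \<le> norm r * norm d"
      using Cauchy_Schwarz_ineq2[of r d] by simp
    ultimately show False
      using opt by linarith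
  qed
  have "?q d \<le> ?q (- d)"
    using dle by (intro min) simp
  then have "?g \<bullet> d \<le> 0"
    by (simp add: quad_model_def blinfun.bilinear_simps)
  have "norm r * norm d \<le> norm r * \<Delta>"
    using dle by (intro mult_left_mono) auto
  \<comment> \<open>Here \<open>2 * (?q 0 - ?q d) = - (r \<bullet> d) - ?g \<bullet> d\<close>, and
    the second summand is nonnegative.\<close>
  with opt \<open>?g \<bullet> d \<le> 0\<close> show "norm (?g + ?H d) * norm d \<le> 2 * (?q 0 - ?q d)"
    unfolding r_def[symmetric]
    by (simp add: quad_model_def blinfun.bilinear_simps r_def inner_simps)
qed

end

section \<open>Taylor estimates under a Hoelder continuous Hessian\<close>

locale hoelder_C2 = C2 +
  fixes L \<nu> :: real
  assumes hoelder: "hoelder_hessian f L \<nu>" and L_pos: "L > 0" and nu_nonneg: "0 \<le> \<nu>"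
begin

text \<open>The mean value inequality on the segment from \<open>y\<close> to \<open>y + d\<close>;
  \<open>1 / (1 + \<nu>)\<close> is the integral of \<open>t powr \<nu>\<close> over the unit
  interval.\<close>

lemma grad_taylor:
  "norm (grad f (y + d) - grad f y - hess f y d) \<le> C_g L \<nu> * norm d powr (1 + \<nu>)"
proof -
  let ?h = "\<lambda>t. grad f (y + t *\<^sub>R d) - t *\<^sub>R hess f y d"
  let ?\<phi> = "\<lambda>t. L * norm d powr (1 + \<nu>) * (t powr (1 + \<nu>) / (1 + \<nu>))"
  have der: "(?h has_vector_derivative hess f (y + t *\<^sub>R d) d - hess f y d) (at t)" for t
    by (auto intro!: derivative_eq_intros grad_line_derivative)
  have "norm (?h 1 - ?h 0) \<le> ?\<phi> 1 - ?\<phi> 0"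
  proof (rule differentiable_bound_general)
    show "continuous_on {0..1} ?h"
      using der by (meson continuous_at_imp_continuous_on has_vector_derivative_continuous)
    \<comment> \<open>The exponent is positive, so continuity includes \<open>t = 0\<close>; the
      derivative is taken in the open interval.\<close>
    show "continuous_on {0..1} ?\<phi>"
      using nu_nonneg by (intro continuous_intros continuous_on_powr') auto
    fix t :: real assume t: "0 < t" "t < 1"
    show "(?h has_vector_derivative hess f (y + t *\<^sub>R d) d - hess f y d) (at t)"
      by (rule der)
    show "(?\<phi> has_vector_derivative L * norm d powr (1 + \<nu>) * t powr \<nu>) (at t)"
      unfolding has_real_derivative_iff_has_vector_derivative[symmetric]
      using t nu_nonneg by (auto intro!: derivative_eq_intros)
    have "norm (hess f (y + t *\<^sub>R d) d - hess f y d) \<le> norm (hess f (y + t *\<^sub>R d) - hess f y) * norm d"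
      unfolding blinfun.diff_left[symmetric] by (rule norm_blinfun)
    also have "\<dots> \<le> (L * norm (y + t *\<^sub>R d - y) powr \<nu>) * norm d"
      by (intro mult_right_mono hoelder[unfolded hoelder_hessian_def, rule_format]) simp
    also have "\<dots> = L * norm d powr (1 + \<nu>) * t powr \<nu>"
      using t by (simp add: powr_mult powr_add)
    finally show "norm (hess f (y + t *\<^sub>R d) d - hess f y d) \<le> L * norm d powr (1 + \<nu>) * t powr \<nu>" .
  qed simp
  then show ?thesis
    by (simp add: C_g_def algebra_simps)
qed

text \<open>Integrates \<open>grad_taylor\<close> once more along the segment, which contributes the
  factor \<open>1 / (2 + \<nu>)\<close>.\<close>

lemma quad_model_taylor:
  "\<bar>f (y + d) - quad_model f y d\<bar> \<le> C_f L \<nu> * norm d powr (2 + \<nu>)"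
proof -
  let ?h = "\<lambda>t. f (y + t *\<^sub>R d) - t * (grad f y \<bullet> d) - t\<^sup>2 / 2 * (hess f y d \<bullet> d)"
  let ?h' = "\<lambda>t. grad f (y + t *\<^sub>R d) \<bullet> d - grad f y \<bullet> d - t * (hess f y d \<bullet> d)"
  let ?\<phi> = "\<lambda>t. C_g L \<nu> * norm d powr (2 + \<nu>) * (t powr (2 + \<nu>) / (2 + \<nu>))"
  have der: "(?h has_real_derivative ?h' t) (at t)" for t
    by (auto intro!: derivative_eq_intros f_line_derivative)
  have "norm (?h 1 - ?h 0) \<le> ?\<phi> 1 - ?\<phi> 0"
  proof (rule differentiable_bound_general)
    show "continuous_on {0..1} ?h"
      using der by (meson continuous_at_imp_continuous_on DERIV_isCont)
    show "continuous_on {0..1} ?\<phi>"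
      using nu_nonneg by (intro continuous_intros continuous_on_powr') auto
    fix t :: real assume t: "0 < t" "t < 1"
    show "(?h has_vector_derivative ?h' t) (at t)"
      using der by (simp add: has_real_derivative_iff_has_vector_derivative)
    show "(?\<phi> has_vector_derivative C_g L \<nu> * norm d powr (2 + \<nu>) * t powr (1 + \<nu>)) (at t)"
      unfolding has_real_derivative_iff_has_vector_derivative[symmetric]
      using t nu_nonneg by (auto intro!: derivative_eq_intros)
    have "?h' t = (grad f (y + t *\<^sub>R d) - grad f y - hess f y (t *\<^sub>R d)) \<bullet> d"
      by (simp add: inner_simps blinfun.bilinear_simps)
    then have "norm (?h' t) \<le> norm (grad f (y + t *\<^sub>R d) - grad f y - hess f y (t *\<^sub>R d)) * norm d"
      by (simp add: Cauchy_Schwarz_ineq2)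
    also have "\<dots> \<le> (C_g L \<nu> * norm (t *\<^sub>R d) powr (1 + \<nu>)) * norm d"
      by (intro mult_right_mono grad_taylor) auto
    also have "\<dots> = C_g L \<nu> * (norm d powr 1 * norm d powr (1 + \<nu>)) * t powr (1 + \<nu>)"
      using t by (simp add: powr_mult)
    also have "\<dots> = C_g L \<nu> * norm d powr (2 + \<nu>) * t powr (1 + \<nu>)"
      unfolding powr_add[symmetric] by simp
    finally show "norm (?h' t) \<le> C_g L \<nu> * norm d powr (2 + \<nu>) * t powr (1 + \<nu>)" .
  qed simp
  moreover have "?h 1 - ?h 0 = f (y + d) - quad_model f y d"
    by (simp add: quad_model_def)
  moreover have "?\<phi> 1 - ?\<phi> 0 = C_f L \<nu> * norm d powr (2 + \<nu>)"
    by (simp add: C_g_def C_f_def)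
  ultimately show ?thesis
    by simp
qed

end

section \<open>Constants and estimates for a single step\<close>

locale cat_params = hoelder_C2 +
  fixes \<theta> \<eta>1 \<eta>2 :: real
  assumes theta_pos: "\<theta> > 0" and eta: "0 < \<eta>1" "\<eta>1 \<le> \<eta>2" "\<eta>2 < 1 / (1 + \<theta>)"
begin

abbreviation "K \<equiv> K_theta L \<nu> \<theta> \<eta>2"
abbreviation "\<alpha> \<equiv> alpha_exp \<nu>"
abbreviation "min_grad y d \<equiv> min (norm (grad f y)) (norm (grad f (y + d)))"

text \<open>Given \<eta>2 < 1, the first claim is the condition
  \<open>a_theta \<theta> \<eta>2 < 1\<close>, with denominators cleared.\<close>

lemma eta_theta: "\<eta>2 + \<eta>2 * \<theta> < 1" and eta2_less_1: "\<eta>2 < 1"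
proof -
  show *: "\<eta>2 + \<eta>2 * \<theta> < 1"
    using eta(3) theta_pos by (simp add: field_simps)
  have "0 < \<eta>2 * \<theta>"
    using eta theta_pos by simp
  with * show "\<eta>2 < 1" by linarith
qed

lemma C_g_pos: "0 < C_g L \<nu>" and C_f_pos: "0 < C_f L \<nu>"
  using L_pos nu_nonneg by (simp_all add: C_g_def C_f_def)

text \<open>The definition of \<open>K\<close> without nested fractions, in the form in which the
  constants arise when the ratio is below \<eta>2.\<close>

lemma K_eq: "K * (1 - \<eta>2 - \<eta>2 * \<theta>) = (1 - \<eta>2) * C_g L \<nu> + 2 * C_f L \<nu>"
proof -
  have a: "1 - a_theta \<theta> \<eta>2 = (1 - \<eta>2 - \<eta>2 * \<theta>) / (1 - \<eta>2)"
    using eta2_less_1 by (simp add: a_theta_def field_simps)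
  have *: "(u + v / E) / (D / E) * D = E * u + v" if "D \<noteq> 0" "E \<noteq> 0" for u v D E :: real
    using that by (simp add: field_simps)
  show ?thesis
    unfolding K_theta_def a using eta2_less_1 eta_theta by (intro *) auto
qed

text \<open>Interior steps produce the constant \<open>C_g\<close>; the comparison lets them share
  the length bound with \<open>K\<close>.\<close>

lemma C_g_le_K: "C_g L \<nu> \<le> K" and K_pos: "0 < K"
proof -
  have "0 < \<eta>2 * \<theta> * C_g L \<nu>"
    using eta theta_pos C_g_pos by simp
  then have "C_g L \<nu> * (1 - \<eta>2 - \<eta>2 * \<theta>) \<le> K * (1 - \<eta>2 - \<eta>2 * \<theta>)"
    unfolding K_eq using C_f_pos by (simp add: algebra_simps)
  then show "C_g L \<nu> \<le> K"
    using eta_theta by simp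
  with C_g_pos show "0 < K" by linarith
qed

lemma norm_grad_step:
  "norm (grad f (y + d)) \<le> norm (grad f y + hess f y d) + C_g L \<nu> * norm d powr (1 + \<nu>)"
proof -
  have "norm (grad f (y + d)) \<le>
      norm (grad f y + hess f y d) + norm (grad f (y + d) - grad f y - hess f y d)"
    using norm_triangle_ineq[of "grad f y + hess f y d" "grad f (y + d) - grad f y - hess f y d"]
    by simp
  with grad_taylor[of y d] show ?thesis by linarith
qed

lemma root_le_norm:
  assumes "0 < \<epsilon>" "\<epsilon> \<le> K * norm d powr (1 + \<nu>)"
  shows "(\<epsilon> / K) powr \<alpha> \<le> norm d"
proof -
  have "(\<epsilon> / K) powr \<alpha> \<le> (norm d powr (1 + \<nu>)) powr \<alpha>"
    using assms K_pos nu_nonneg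
    by (intro powr_mono2) (simp_all add: alpha_exp_def field_simps)
  also have "\<dots> = norm d"
    using nu_nonneg by (simp add: powr_powr alpha_exp_def)
  finally show ?thesis .
qed

context
  fixes y d :: 'a and \<Delta> \<epsilon> :: real
  assumes step: "is_arg_min (quad_model f y) (\<lambda>e. norm e \<le> \<Delta>) d" and radius_pos: "\<Delta> > 0"
    and eps: "0 < \<epsilon>" "\<epsilon> < min_grad y d"
begin

text \<open>A zero step would be interior, so its residual \<open>grad f y\<close> would vanish,
  against the lower bound \<epsilon> on the gradient norm.\<close>

lemma step_nonzero: "d \<noteq> 0"
  using exact_step(1)[OF step radius_pos] eps radius_pos by (auto simp: blinfun.bilinear_simps)

lemma step_le_radius: "norm d \<le> \<Delta>"
  using step unfolding is_arg_min_def by blast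

lemma predicted_decrease: "norm (grad f y + hess f y d) * norm d \<le> 2 * (quad_model f y 0 - quad_model f y d)"
  by (rule exact_step(2)[OF step radius_pos])

text \<open>The predicted decrease is nonnegative, so the gradient term alone bounds the denominator
  from below. Positivity allows ratio inequalities to be multiplied out.\<close>

lemma cat_denominator:
  "\<theta> / 2 * \<epsilon> * norm d \<le> quad_model f y 0 - quad_model f y d + \<theta> / 2 * min_grad y d * norm d"
  "0 < quad_model f y 0 - quad_model f y d + \<theta> / 2 * min_grad y d * norm d"
proof -
  have "0 \<le> 2 * (quad_model f y 0 - quad_model f y d)"
    by (rule order_trans[OF _ predicted_decrease]) simp
  then have "0 \<le> quad_model f y 0 - quad_model f y d"
    by simp
  moreover have "\<theta> / 2 * \<epsilon> * norm d \<le> \<theta> / 2 * min_grad y d * norm d"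
    using theta_pos eps by (intro mult_right_mono mult_left_mono) auto
  moreover have "0 < \<theta> / 2 * \<epsilon> * norm d"
    using theta_pos eps step_nonzero by simp
  ultimately show
    "\<theta> / 2 * \<epsilon> * norm d \<le> quad_model f y 0 - quad_model f y d + \<theta> / 2 * min_grad y d * norm d"
    "0 < quad_model f y 0 - quad_model f y d + \<theta> / 2 * min_grad y d * norm d"
    by linarith+
qed

lemma radius_large_if_not_very_successful:
  assumes "cat_ratio f \<theta> y d < \<eta>2"
  shows "(\<epsilon> / K) powr \<alpha> \<le> \<Delta>"
proof -
  define N where "N = norm d"
  define P where "P = N powr (1 + \<nu>)"
  define r where "r = norm (grad f y + hess f y d)"
  define p where "p = quad_model f y 0 - quad_model f y d"
  define m where "m = min_grad y d"
  have N: "N > 0"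
    using step_nonzero by (simp add: N_def)
  have NP: "norm d powr (2 + \<nu>) = N * P"
  proof -
    have "N powr (1 + (1 + \<nu>)) = N powr 1 * N powr (1 + \<nu>)"
      by (rule powr_add)
    then show ?thesis using N by (simp add: P_def N_def)
  qed
  have "f y - f (y + d) < \<eta>2 * (p + \<theta> / 2 * m * N)"
    using assms cat_denominator(2) unfolding cat_ratio_def p_def m_def N_def
    by (simp add: pos_divide_less_eq)
  moreover have "p - C_f L \<nu> * (N * P) \<le> f y - f (y + d)"
    using quad_model_taylor[of y d] unfolding NP
    by (simp add: p_def quad_model_def blinfun.bilinear_simps)
  ultimately have "(1 - \<eta>2) * (2 * p) < 2 * C_f L \<nu> * (N * P) + \<eta>2 * \<theta> * m * N"
    by (simp add: algebra_simps)
  \<comment> \<open>Replacing \<open>2 * p\<close> by \<open>r * N\<close> gives every term a factor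
    \<open>N\<close>, which is then cancelled.\<close>
  moreover have "(1 - \<eta>2) * (r * N) \<le> (1 - \<eta>2) * (2 * p)"
    using predicted_decrease eta2_less_1
    by (intro mult_left_mono) (auto simp: r_def N_def p_def)
  ultimately have "((1 - \<eta>2) * r) * N < (2 * C_f L \<nu> * P + \<eta>2 * \<theta> * m) * N"
    by (simp add: algebra_simps)
  then have "(1 - \<eta>2) * r < 2 * C_f L \<nu> * P + \<eta>2 * \<theta> * m"
    using N by simp
  \<comment> \<open>This turns the bound on \<open>r\<close> into one on \<open>m\<close>; the term
    \<open>\<eta>2 * \<theta> * m\<close> then moves to the left and yields the coefficient in
    \<open>K_eq\<close>.\<close>
  moreover have "(1 - \<eta>2) * m \<le> (1 - \<eta>2) * (r + C_g L \<nu> * P)"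
    using norm_grad_step[of y d] eta2_less_1
    by (intro mult_left_mono) (auto simp: r_def P_def N_def m_def)
  ultimately have "m * (1 - \<eta>2 - \<eta>2 * \<theta>) \<le> ((1 - \<eta>2) * C_g L \<nu> + 2 * C_f L \<nu>) * P"
    by (simp add: algebra_simps)
  also have "\<dots> = (K * P) * (1 - \<eta>2 - \<eta>2 * \<theta>)"
    unfolding K_eq[symmetric] by simp
  finally have "m \<le> K * P"
    using eta_theta by simp
  then have "(\<epsilon> / K) powr \<alpha> \<le> norm d"
    using eps by (intro root_le_norm) (auto simp: m_def P_def N_def)
  with step_le_radius show ?thesis by linarith
qed

text \<open>An interior step has zero residual, so \<open>norm_grad_step\<close> bounds the new
  gradient, and with it \<epsilon>, by the Taylor term alone.\<close>

lemma step_long: "norm d = \<Delta> \<or> (\<epsilon> / K) powr \<alpha> \<le> norm d"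
proof (cases "norm d < \<Delta>")
  case True
  have "\<epsilon> \<le> C_g L \<nu> * norm d powr (1 + \<nu>)"
    using norm_grad_step[of y d] eps exact_step(1)[OF step radius_pos True] by simp
  also have "\<dots> \<le> K * norm d powr (1 + \<nu>)"
    by (intro mult_right_mono C_g_le_K) simp
  finally show ?thesis
    using eps root_le_norm by blast
next
  case False
  with step_le_radius show ?thesis by simp
qed

lemma decrease_if_successful:
  assumes "\<eta>1 \<le> cat_ratio f \<theta> y d"
  shows "\<eta>1 * (\<theta> / 2 * \<epsilon> * norm d) \<le> f y - f (y + d)"
proof -
  have "\<eta>1 * (quad_model f y 0 - quad_model f y d + \<theta> / 2 * min_grad y d * norm d) \<le> f y - f (y + d)"
    using assms cat_denominator(2) unfolding cat_ratio_def by (simp add: pos_le_divide_eq)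
  moreover have "\<eta>1 * (\<theta> / 2 * \<epsilon> * norm d) \<le>
      \<eta>1 * (quad_model f y 0 - quad_model f y d + \<theta> / 2 * min_grad y d * norm d)"
    using cat_denominator(1) eta by (intro mult_left_mono) auto
  ultimately show ?thesis by linarith
qed

end

end

section \<open>Radii and iteration counts along a run\<close>

locale cat_run = cat_params +
  fixes \<gamma>1 \<gamma>2 \<gamma>3 \<Delta>0 :: real and x0 :: 'a and x s :: "nat \<Rightarrow> 'a" and \<Delta> :: "nat \<Rightarrow> real"
  assumes gamma: "0 < \<gamma>1" "\<gamma>1 \<le> \<gamma>2" "\<gamma>2 < 1" "1 \<le> \<gamma>3"
    and initial_radius_pos: "\<Delta>0 > 0"
    and bdd_below: "bdd_below (range f)"
    and run: "unicat_run f \<theta> \<eta>1 \<eta>2 \<gamma>1 \<gamma>2 \<gamma>3 x0 \<Delta>0 x s \<Delta>"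
    and nonterminating: "nonterminating f x"
begin

abbreviation "\<rho> k \<equiv> cat_ratio f \<theta> (x k) (s k)"

lemma run_step:
  "is_arg_min (quad_model f (x k)) (\<lambda>e. norm e \<le> \<Delta> k) (s k)"
  "x (Suc k) = (if \<rho> k \<ge> \<eta>1 then x k + s k else x k)"
  "\<Delta> (Suc k) \<in> (if \<rho> k < \<eta>1 then {\<gamma>1 * \<Delta> k .. \<gamma>2 * \<Delta> k}
     else if \<rho> k < \<eta>2 then {\<gamma>2 * \<Delta> k .. \<Delta> k} else {\<Delta> k .. \<gamma>3 * \<Delta> k})"
  using run nonterminating unfolding unicat_run_def nonterminating_def Let_def
  by (metis less_irrefl)+

lemma run_initial: "x 0 = x0" "\<Delta> 0 = \<Delta>0"
  using run unfolding unicat_run_def by auto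

lemma radius_pos: "\<Delta> k > 0"
proof (induction k)
  case 0
  then show ?case using initial_radius_pos run_initial by simp
next
  case (Suc k)
  then have "0 < \<gamma>1 * \<Delta> k" "0 < \<gamma>2 * \<Delta> k"
    using gamma by simp_all
  with Suc run_step(3)[of k] show ?case
    by (auto split: if_splits)
qed

definition successes :: "nat \<Rightarrow> real" where
  "successes k = (\<Sum>j<k. if \<rho> j < \<eta>1 then 0 else 1)"

definition failures :: "nat \<Rightarrow> real" where
  "failures k = (\<Sum>j<k. if \<rho> j < \<eta>1 then 1 else 0)"

lemma successes_plus_failures: "successes k + failures k = real k"
  unfolding successes_def failures_def by (induction k) auto

text \<open>On the logarithmic scale a failure subtracts at least
  \<open>\<bar>ln \<gamma>2\<bar>\<close> and a success adds at most \<open>ln \<gamma>3\<close>.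
  Against a lower bound on the radius this limits failures in terms of successes.\<close>

lemma ln_radius_le: "ln (\<Delta> k) \<le> ln \<Delta>0 + successes k * ln \<gamma>3 - failures k * \<bar>ln \<gamma>2\<bar>"
proof (induction k)
  case 0
  then show ?case by (simp add: run_initial successes_def failures_def)
next
  case (Suc k)
  have ln2: "\<bar>ln \<gamma>2\<bar> = - ln \<gamma>2"
    using gamma by simp
  have ln_mono: "ln (\<Delta> (Suc k)) \<le> ln c + ln (\<Delta> k)" if "\<Delta> (Suc k) \<le> c * \<Delta> k" "c > 0" for c
  proof -
    have "ln (\<Delta> (Suc k)) \<le> ln (c * \<Delta> k)"
      using that radius_pos[of "Suc k"] by simp
    then show ?thesis
      using that radius_pos[of k] by (simp add: ln_mult)
  qed
  show ?case
  proof (cases "\<rho> k < \<eta>1")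
    case True
    then have "ln (\<Delta> (Suc k)) \<le> ln \<gamma>2 + ln (\<Delta> k)"
      using run_step(3)[of k] gamma by (intro ln_mono) auto
    then show ?thesis
      using Suc True unfolding ln2 by (simp add: successes_def failures_def algebra_simps)
  next
    case False
    \<comment> \<open>Covers successes with ratio below \<eta>2, where the radius does not
      grow.\<close>
    have "\<Delta> k \<le> \<gamma>3 * \<Delta> k"
      using gamma radius_pos[of k] by simp
    then have "ln (\<Delta> (Suc k)) \<le> ln \<gamma>3 + ln (\<Delta> k)"
      using run_step(3)[of k] gamma False by (intro ln_mono) (auto split: if_splits)
    then show ?thesis
      using Suc False by (simp add: successes_def failures_def algebra_simps)
  qed
qed

context
  fixes \<epsilon> :: real
  assumes eps: "0 < \<epsilon>" "\<epsilon> \<le> (\<Delta>0 / \<gamma>1) powr (1 + \<nu>) * K"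
begin

text \<open>The factor \<gamma>1 is the worst shrinkage of a radius that was still at least
  \<open>(\<epsilon> / K) powr \<alpha>\<close>.\<close>

abbreviation "\<delta> \<equiv> \<gamma>1 * (\<epsilon> / K) powr \<alpha>"

lemma delta_pos: "0 < \<delta>"
  using eps K_pos gamma by simp

text \<open>The radius can shrink only if the ratio is below \<eta>2; it was then at least
  \<open>(\<epsilon> / K) powr \<alpha>\<close>, and one reduction leaves at least \<delta>.\<close>

lemma radius_ge:
  assumes "\<And>j. j < k \<Longrightarrow> \<not> cat_reached f x s \<epsilon> j"
  shows "\<delta> \<le> \<Delta> k"
  using assms
proof (induction k)
  case 0
  \<comment> \<open>The upper bound on \<epsilon> is exactly the condition that the initial radius
    is at least \<delta>.\<close>
  have "(\<epsilon> / K) powr \<alpha> \<le> ((\<Delta>0 / \<gamma>1) powr (1 + \<nu>)) powr \<alpha>"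
    using eps K_pos nu_nonneg
    by (intro powr_mono2) (simp_all add: alpha_exp_def field_simps)
  also have "\<dots> = \<Delta>0 / \<gamma>1"
    using nu_nonneg initial_radius_pos gamma by (simp add: powr_powr alpha_exp_def)
  finally show ?case
    using gamma by (simp add: run_initial field_simps)
next
  case (Suc k)
  then have IH: "\<delta> \<le> \<Delta> k" and not_reached: "\<epsilon> < min_grad (x k) (s k)"
    unfolding cat_reached_def not_le by simp_all
  show ?case
  proof (cases "\<rho> k < \<eta>2")
    case True
    have "\<delta> \<le> \<gamma>1 * \<Delta> k"
      using radius_large_if_not_very_successful[OF run_step(1) radius_pos eps(1) not_reached True]
        gamma by simp
    also have "\<dots> \<le> \<gamma>2 * \<Delta> k"
      using gamma radius_pos[of k] by simp
    finally show ?thesis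
      using run_step(3)[of k] True \<open>\<delta> \<le> \<gamma>1 * \<Delta> k\<close> by (auto split: if_splits)
  next
    case False
    then show ?thesis
      using run_step(3)[of k] IH eta by auto
  qed
qed

text \<open>The decreases telescope: failures leave the iterate unchanged, and each success gains at
  least the fixed amount.\<close>

lemma successes_decrease:
  assumes "\<And>j. j < k \<Longrightarrow> \<not> cat_reached f x s \<epsilon> j"
  shows "successes k * (\<eta>1 * (\<theta> / 2 * \<epsilon> * \<delta>)) \<le> f x0 - f (x k)"
  using assms
proof (induction k)
  case 0
  then show ?case by (simp add: run_initial successes_def)
next
  case (Suc k)
  then have not_reached: "\<epsilon> < min_grad (x k) (s k)"
    unfolding cat_reached_def not_le by simp
  note ctx = run_step(1) radius_pos eps(1) not_reached
  have IH: "successes k * (\<eta>1 * (\<theta> / 2 * \<epsilon> * \<delta>)) \<le> f x0 - f (x k)"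
    using Suc by simp
  show ?case
  proof (cases "\<rho> k < \<eta>1")
    case True
    then show ?thesis
      using IH run_step(2)[of k] by (simp add: successes_def)
  next
    case False
    \<comment> \<open>So \<delta> lies below both alternatives of \<open>step_long\<close>.\<close>
    have "\<delta> \<le> (\<epsilon> / K) powr \<alpha>"
      using gamma by (intro mult_left_le_one_le) auto
    moreover have "\<delta> \<le> \<Delta> k"
      using Suc by (intro radius_ge) simp
    ultimately have "\<delta> \<le> norm (s k)"
      using step_long[OF ctx] by auto
    then have "\<eta>1 * (\<theta> / 2 * \<epsilon> * \<delta>) \<le> \<eta>1 * (\<theta> / 2 * \<epsilon> * norm (s k))"
      using eta theta_pos eps by (intro mult_left_mono) auto
    also have "\<dots> \<le> f (x k) - f (x (Suc k))"
      using decrease_if_successful[OF ctx] False run_step(2)[of k] by simp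
    finally have "\<eta>1 * (\<theta> / 2 * \<epsilon> * \<delta>) \<le> f (x k) - f (x (Suc k))" .
    moreover have "successes (Suc k) = successes k + 1"
      using False by (simp add: successes_def)
    ultimately show ?thesis
      using IH by (simp only: distrib_right)
  qed
qed

text \<open>Adds the bounds on successes and failures. It holds for every \<open>k\<close> before
  which the criterion was never met, so it serves both existence of a hitting index and the bound on
  the least one.\<close>

lemma iterations_le:
  assumes "\<And>j. j < k \<Longrightarrow> \<not> cat_reached f x s \<epsilon> j"
  shows "real k \<le> (1 + ln \<gamma>3 / \<bar>ln \<gamma>2\<bar>)
             * (C_cat (f x0 - (INF z. f z)) L \<nu> \<theta> \<eta>1 \<eta>2 \<gamma>1 / \<epsilon> powr ((2 + \<nu>) / (1 + \<nu>)))
           + 1 / \<bar>ln \<gamma>2\<bar> * log_plus (\<Delta>0 * K powr \<alpha> / (\<gamma>1 * \<epsilon> powr \<alpha>))"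
proof -
  let ?S = "C_cat (f x0 - (INF z. f z)) L \<nu> \<theta> \<eta>1 \<eta>2 \<gamma>1 / \<epsilon> powr ((2 + \<nu>) / (1 + \<nu>))"
  let ?l = "\<bar>ln \<gamma>2\<bar>" and ?T = "log_plus (\<Delta>0 * K powr \<alpha> / (\<gamma>1 * \<epsilon> powr \<alpha>))"
  have l: "?l > 0"
    using gamma by simp
  have delta: "\<delta> = \<gamma>1 * \<epsilon> powr \<alpha> / K powr \<alpha>"
    using eps K_pos by (simp add: powr_divide)
  have c: "0 < \<eta>1 * (\<theta> / 2 * \<epsilon> * \<delta>)"
    using delta_pos eta theta_pos eps by simp
  have S: "successes k \<le> ?S"
  proof -
    have "(INF z. f z) \<le> f (x k)"
      by (rule cINF_lower[OF bdd_below]) simp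
    moreover have "successes k * (\<eta>1 * (\<theta> / 2 * \<epsilon> * \<delta>)) \<le> f x0 - f (x k)"
      by (rule successes_decrease) (rule assms)
    ultimately have "successes k * (\<eta>1 * (\<theta> / 2 * \<epsilon> * \<delta>)) \<le> f x0 - (INF z. f z)"
      by linarith
    then have "successes k \<le> (f x0 - (INF z. f z)) / (\<eta>1 * (\<theta> / 2 * \<epsilon> * \<delta>))"
      using c by (simp only: pos_le_divide_eq)
    also have "\<dots> = ?S"
    proof -
      \<comment> \<open>One factor \<epsilon> comes from the gradient norm in the decrease, the
        factor \<open>\<epsilon> powr \<alpha>\<close> from the step length \<delta>.\<close>
      have "(2 + \<nu>) / (1 + \<nu>) = 1 + \<alpha>"
        using nu_nonneg by (simp add: alpha_exp_def field_simps)
      then have "\<epsilon> powr ((2 + \<nu>) / (1 + \<nu>)) = \<epsilon> * \<epsilon> powr \<alpha>"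
        using eps by (simp add: powr_add)
      then show ?thesis
        unfolding delta C_cat_def using K_pos by (simp add: field_simps)
    qed
    finally show ?thesis .
  qed
  have "\<delta> \<le> \<Delta> k"
    by (rule radius_ge) (rule assms)
  then have "ln \<delta> \<le> ln (\<Delta> k)"
    using delta_pos radius_pos[of k] by simp
  then have "failures k * ?l \<le> (ln \<Delta>0 - ln \<delta>) + successes k * ln \<gamma>3"
    using ln_radius_le[of k] by linarith
  also have "ln \<Delta>0 - ln \<delta> = ln (\<Delta>0 * K powr \<alpha> / (\<gamma>1 * \<epsilon> powr \<alpha>))"
  proof -
    have "ln \<Delta>0 - ln \<delta> = ln (\<Delta>0 / \<delta>)"
      using initial_radius_pos delta_pos by (subst ln_div) (metis less_irrefl)+
    then show ?thesis
      unfolding delta by simp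
  qed
  also have "\<dots> \<le> ?T"
    by (simp add: log_plus_def)
  finally have "failures k \<le> (?T + successes k * ln \<gamma>3) / ?l"
    using l by (simp add: pos_le_divide_eq)
  then have "real k \<le> (1 + ln \<gamma>3 / ?l) * successes k + 1 / ?l * ?T"
    unfolding successes_plus_failures[symmetric] by (simp add: field_simps add_divide_distrib)
  also have "\<dots> \<le> (1 + ln \<gamma>3 / ?l) * ?S + 1 / ?l * ?T"
    using S gamma by (intro add_right_mono mult_left_mono) auto
  finally show ?thesis .
qed

lemma cat_complexity:
  "\<exists>k. cat_reached f x s \<epsilon> k"
  "real (k_cat_ncvx f x s \<epsilon>) \<le> (1 + ln \<gamma>3 / \<bar>ln \<gamma>2\<bar>)
     * (C_cat (f x0 - (INF z. f z)) L \<nu> \<theta> \<eta>1 \<eta>2 \<gamma>1 / \<epsilon> powr ((2 + \<nu>) / (1 + \<nu>)))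
   + 1 / \<bar>ln \<gamma>2\<bar> * log_plus (\<Delta>0 * K powr \<alpha> / (\<gamma>1 * \<epsilon> powr \<alpha>))" (is "_ \<le> ?B")
proof -
  show "\<exists>k. cat_reached f x s \<epsilon> k"
  proof (rule ccontr)
    assume "\<nexists>k. cat_reached f x s \<epsilon> k"
    \<comment> \<open>If the criterion were never met, the same bound would hold for all natural
      numbers.\<close>
    then have "real k \<le> ?B" for k
      by (intro iterations_le) blast
    then show False
      using reals_Archimedean2 not_less by blast
  qed
  show "real (k_cat_ncvx f x s \<epsilon>) \<le> ?B"
    unfolding k_cat_ncvx_def by (intro iterations_le) (rule not_less_Least)
qed

end

end

section \<open>Asymptotic form and conclusion\<close>

text \<open>The logarithm is at most its argument, of order
  \<open>\<epsilon> powr (- alpha_exp \<nu>)\<close>; for \<epsilon> \<le> 1 the larger exponent of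
  the first summand absorbs it.\<close>

lemma power_plus_log_bound:
  fixes \<nu> :: real
  assumes "0 \<le> \<nu>" "0 \<le> c" "0 < l" "0 < D" "0 < \<gamma>" "0 < \<epsilon>" "\<epsilon> \<le> 1"
  shows "c / \<epsilon> powr ((2 + \<nu>) / (1 + \<nu>)) + 1 / l * log_plus (D / (\<gamma> * \<epsilon> powr alpha_exp \<nu>))
    \<le> (c + D / (l * \<gamma>)) * \<epsilon> powr (- ((2 + \<nu>) / (1 + \<nu>)))"
proof -
  let ?p = "(2 + \<nu>) / (1 + \<nu>)" and ?B = "D / (\<gamma> * \<epsilon> powr alpha_exp \<nu>)"
  have "0 < ?B"
    using assms by simp
  then have "log_plus ?B \<le> ?B"
    using ln_bound[of ?B] by (simp add: log_plus_def)
  also have "\<dots> = D / \<gamma> * \<epsilon> powr (- alpha_exp \<nu>)"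
    by (simp add: powr_minus_divide)
  also have "\<dots> \<le> D / \<gamma> * \<epsilon> powr (- ?p)"
    using assms by (intro mult_left_mono powr_mono') (auto simp: alpha_exp_def divide_simps)
  finally have "1 / l * log_plus ?B \<le> 1 / l * (D / \<gamma> * \<epsilon> powr (- ?p))"
    using assms by (intro mult_left_mono) auto
  also have "\<dots> = D / (l * \<gamma>) * \<epsilon> powr (- ?p)"
    by simp
  finally show ?thesis
    by (simp only: powr_minus_divide distrib_right times_divide_eq_right mult_1_right add_divide_distrib add_left_mono)
qed

theorem theorem18:
  fixes f :: "'a::euclidean_space \<Rightarrow> real"
    and x0 :: 'a
    and L \<nu> \<theta> \<eta>1 \<eta>2 \<gamma>1 \<gamma>2 \<gamma>3 \<Delta>0 :: real
  assumes "twice_continuously_differentiable f"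
    and "bdd_below (range f)"
    and "\<exists>z. \<forall>y. f z \<le> f y"
    and "L > 0" and "0 \<le> \<nu>" and "\<nu> \<le> 1"
    and "hoelder_hessian f L \<nu>"
    and "\<Delta>0 > 0" and "\<theta> > 0"
    and "0 < \<eta>1" and "\<eta>1 \<le> \<eta>2" and "\<eta>2 < 1"
    and "0 < \<gamma>1" and "\<gamma>1 \<le> \<gamma>2" and "\<gamma>2 < 1" and "1 \<le> \<gamma>3"
    and "\<eta>2 < 1 / (1 + \<theta>)"
  shows "(\<forall>x s \<Delta>.
            unicat_run f \<theta> \<eta>1 \<eta>2 \<gamma>1 \<gamma>2 \<gamma>3 x0 \<Delta>0 x s \<Delta> \<and> nonterminating f x \<longrightarrow>
            (\<forall>\<epsilon>. 0 < \<epsilon> \<and> \<epsilon> \<le> (\<Delta>0 / \<gamma>1) powr (1 + \<nu>) * K_theta L \<nu> \<theta> \<eta>2 \<longrightarrow>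
               (\<exists>k. cat_reached f x s \<epsilon> k) \<and>
               real (k_cat_ncvx f x s \<epsilon>)
                 \<le> (1 + ln \<gamma>3 / \<bar>ln \<gamma>2\<bar>)
                     * (C_cat (f x0 - (INF z. f z)) L \<nu> \<theta> \<eta>1 \<eta>2 \<gamma>1
                         / \<epsilon> powr ((2 + \<nu>) / (1 + \<nu>)))
                   + 1 / \<bar>ln \<gamma>2\<bar>
                     * log_plus (\<Delta>0 * K_theta L \<nu> \<theta> \<eta>2 powr alpha_exp \<nu>
                                  / (\<gamma>1 * \<epsilon> powr alpha_exp \<nu>))))
       \<and> (\<exists>C > 0. \<exists>\<epsilon>0 > 0. \<forall>x s \<Delta>.
            unicat_run f \<theta> \<eta>1 \<eta>2 \<gamma>1 \<gamma>2 \<gamma>3 x0 \<Delta>0 x s \<Delta> \<and> nonterminating f x \<longrightarrow>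
            (\<forall>\<epsilon>. 0 < \<epsilon> \<and> \<epsilon> \<le> \<epsilon>0 \<longrightarrow>
               (\<exists>k. cat_reached f x s \<epsilon> k) \<and>
               real (k_cat_ncvx f x s \<epsilon>) \<le> C * \<epsilon> powr (- ((2 + \<nu>) / (1 + \<nu>)))))"
proof -
  let ?F0 = "f x0 - (INF z. f z)" and ?K = "K_theta L \<nu> \<theta> \<eta>2"
  let ?bound = "\<lambda>\<epsilon>. (1 + ln \<gamma>3 / \<bar>ln \<gamma>2\<bar>)
      * (C_cat ?F0 L \<nu> \<theta> \<eta>1 \<eta>2 \<gamma>1 / \<epsilon> powr ((2 + \<nu>) / (1 + \<nu>)))
    + 1 / \<bar>ln \<gamma>2\<bar> * log_plus (\<Delta>0 * ?K powr alpha_exp \<nu> / (\<gamma>1 * \<epsilon> powr alpha_exp \<nu>))"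
  let ?c = "(1 + ln \<gamma>3 / \<bar>ln \<gamma>2\<bar>) * C_cat ?F0 L \<nu> \<theta> \<eta>1 \<eta>2 \<gamma>1"
  let ?C = "?c + \<Delta>0 * ?K powr alpha_exp \<nu> / (\<bar>ln \<gamma>2\<bar> * \<gamma>1)"
  \<comment> \<open>The 1 is for \<open>power_plus_log_bound\<close>, the other term for the range
    of the explicit bound.\<close>
  let ?\<epsilon>0 = "min 1 ((\<Delta>0 / \<gamma>1) powr (1 + \<nu>) * ?K)"
  interpret cat_params f L \<nu> \<theta> \<eta>1 \<eta>2
    using assms by unfold_locales auto
  have bound: "(\<exists>k. cat_reached f x s \<epsilon> k) \<and> real (k_cat_ncvx f x s \<epsilon>) \<le> ?bound \<epsilon>"
    if "unicat_run f \<theta> \<eta>1 \<eta>2 \<gamma>1 \<gamma>2 \<gamma>3 x0 \<Delta>0 x s \<Delta>" "nonterminating f x"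
      "0 < \<epsilon>" "\<epsilon> \<le> (\<Delta>0 / \<gamma>1) powr (1 + \<nu>) * ?K" for x s \<Delta> \<epsilon>
  proof -
    interpret cat_run f L \<nu> \<theta> \<eta>1 \<eta>2 \<gamma>1 \<gamma>2 \<gamma>3 \<Delta>0 x0 x s \<Delta>
      using assms that by unfold_locales auto
    show ?thesis
      using cat_complexity[OF that(3,4)] by blast
  qed
  have l: "\<bar>ln \<gamma>2\<bar> > 0"
    using assms by simp
  have "0 \<le> ?F0"
    using cINF_lower[OF assms(2), of x0] by simp
  then have "0 \<le> C_cat ?F0 L \<nu> \<theta> \<eta>1 \<eta>2 \<gamma>1"
    unfolding C_cat_def using assms by (intro divide_nonneg_nonneg mult_nonneg_nonneg) auto
  then have c: "0 \<le> ?c"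
    using assms by (intro mult_nonneg_nonneg add_nonneg_nonneg divide_nonneg_nonneg) auto
  have D: "0 < \<Delta>0 * ?K powr alpha_exp \<nu>"
    using assms K_pos by simp
  \<comment> \<open>No run is fixed here, so \<open>?c\<close> is only known to be nonnegative;
    strict positivity comes from the logarithmic summand.\<close>
  have "0 < ?C"
    using c D l assms by (intro add_nonneg_pos divide_pos_pos mult_pos_pos) auto
  moreover have "0 < ?\<epsilon>0"
    using assms K_pos by simp
  moreover have "(\<exists>k. cat_reached f x s \<epsilon> k)
      \<and> real (k_cat_ncvx f x s \<epsilon>) \<le> ?C * \<epsilon> powr (- ((2 + \<nu>) / (1 + \<nu>)))"
    if "unicat_run f \<theta> \<eta>1 \<eta>2 \<gamma>1 \<gamma>2 \<gamma>3 x0 \<Delta>0 x s \<Delta>" "nonterminating f x"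
      "0 < \<epsilon>" "\<epsilon> \<le> ?\<epsilon>0" for x s \<Delta> \<epsilon>
  proof -
    have "?bound \<epsilon> \<le> ?C * \<epsilon> powr (- ((2 + \<nu>) / (1 + \<nu>)))"
      using power_plus_log_bound[OF assms(5) c l D assms(13) that(3)] that(4) by simp
    with bound[OF that(1-3)] that(4) show ?thesis
      by fastforce
  qed
  ultimately show ?thesis
    using bound by blast
qed

end
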